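(* There are infinitely many graphs $G$ for which $\chi_{DP}(G)=3$, $P_{DP}(G,3)=P(G,3)$, and there is an $N_G\in\mathbb{N}$ such that $P_{DP}(G,m) < P(G,m)$ for all $m \geq N_G$.
   Context: Graphs are finite simple graphs. $P(G,m)$ denotes the chromatic polynomial (the number of proper colorings of $G$ with colors from $\{1,\dots,m\}$). A cover of $G$ is a triple $\mathcal{H}=(L,H,M)$ where $L$ assigns to each $v\in V(G)$ a set $L(v)=\{(v,a): a\in A_v\}$ with $A_v$ a nonempty finite set, $H$ is a graph with vertex set $\bigcup_{v} L(v)$, and $M$ assigns to each edge $uv\in E(G)$ a matching $M(uv)$ between $L(u)$ and $L(v)$, such that $H[L(u)]$ is complete for every $u$, and for distinct $u,v$ the edges of $H$ between $L(u)$ and $L(v)$ are exactly those of $M(uv)$ if $uv\in E(G)$ and none otherwise. An $\mathcal{H}$-coloring of $G$ is an independent set in $H$ of size $|V(G)|$. The cover is $m$-fold if $|L(u)|=m$ for all $u$, and full $m$-fold if moreover $|M(uv)|=m$ for every edge $uv$. $\chi_{DP}(G)$ is the least $k$ such that $G$ has an $\mathcal{H}$-coloring for every $k$-fold cover $\mathcal{H}$. $P_{DP}(G,m)$ is the minimum, over all full $m$-fold covers $\mathcal{H}$, of the number of $\mathcal{H}$-colorings of $G$. *)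

theory Defs
  imports Main "HOL-Library.FuncSet"
begin

record 'a ugraph =
  verts :: "'a set"
  edges :: "'a set set"

definition finite_simple_graph :: "'a ugraph \<Rightarrow> bool" where
  "finite_simple_graph G \<longleftrightarrow>
     finite (verts G) \<and> (\<forall>e\<in>edges G. e \<subseteq> verts G \<and> card e = 2)"

definition isomorphic :: "'a ugraph \<Rightarrow> 'b ugraph \<Rightarrow> bool" where
  "isomorphic G G' \<longleftrightarrow>
     (\<exists>f. bij_betw f (verts G) (verts G') \<and>
          (\<forall>u\<in>verts G. \<forall>v\<in>verts G. {u, v} \<in> edges G \<longleftrightarrow> {f u, f v} \<in> edges G'))"

definition independent_set :: "'a ugraph \<Rightarrow> 'a set \<Rightarrow> bool" where
  "independent_set G I \<longleftrightarrow> I \<subseteq> verts G \<and> (\<forall>x\<in>I. \<forall>y\<in>I. {x, y} \<notin> edges G)"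

definition induced_subgraph :: "'a ugraph \<Rightarrow> 'a set \<Rightarrow> 'a ugraph" where
  "induced_subgraph G S = \<lparr>verts = verts G \<inter> S, edges = {e \<in> edges G. e \<subseteq> S}\<rparr>"

definition complete_graph :: "'a ugraph \<Rightarrow> bool" where
  "complete_graph G \<longleftrightarrow> (\<forall>x\<in>verts G. \<forall>y\<in>verts G. x \<noteq> y \<longrightarrow> {x, y} \<in> edges G)"

definition pairs_between :: "'a set \<Rightarrow> 'a set \<Rightarrow> 'a set set" where
  "pairs_between A B = {{x, y} | x y. x \<in> A \<and> y \<in> B}"

definition matching_between :: "'a set \<Rightarrow> 'a set \<Rightarrow> 'a set set \<Rightarrow> bool" where
  "matching_between A B F \<longleftrightarrow> F \<subseteq> pairs_between A B \<and> pairwise disjnt F"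

definition proper_colorings :: "'a ugraph \<Rightarrow> nat \<Rightarrow> ('a \<Rightarrow> nat) set" where
  "proper_colorings G m =
     {f \<in> verts G \<rightarrow>\<^sub>E {1..m}. \<forall>u v. {u, v} \<in> edges G \<longrightarrow> f u \<noteq> f v}"

definition chromatic_polynomial :: "'a ugraph \<Rightarrow> nat \<Rightarrow> nat" where
  "chromatic_polynomial G m = card (proper_colorings G m)"

text \<open>
  Second components of cover vertices are natural numbers.  As every list is finite, this
  represents all covers up to relabelling.  The list function is relevant only on vertices of
  the covered graph, and the matching function only on its edges.
\<close>

record 'a cover =
  cover_list :: "'a \<Rightarrow> ('a \<times> nat) set"
  cover_graph :: "('a \<times> nat) ugraph"
  cover_matching :: "'a set \<Rightarrow> ('a \<times> nat) set set"

definition is_cover :: "'a ugraph \<Rightarrow> 'a cover \<Rightarrow> bool" where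
  "is_cover G C \<longleftrightarrow>
     (\<forall>v\<in>verts G. \<exists>A. finite A \<and> A \<noteq> {} \<and> cover_list C v = {(v, a) | a. a \<in> A}) \<and>
     finite_simple_graph (cover_graph C) \<and>
     verts (cover_graph C) = (\<Union>v\<in>verts G. cover_list C v) \<and>
     (\<forall>u v. {u, v} \<in> edges G \<longrightarrow>
        matching_between (cover_list C u) (cover_list C v) (cover_matching C {u, v})) \<and>
     (\<forall>u\<in>verts G. complete_graph (induced_subgraph (cover_graph C) (cover_list C u))) \<and>
     (\<forall>u\<in>verts G. \<forall>v\<in>verts G. u \<noteq> v \<longrightarrow>
        edges (cover_graph C) \<inter> pairs_between (cover_list C u) (cover_list C v) =
        (if {u, v} \<in> edges G then cover_matching C {u, v} else {}))"

definition is_fold_cover :: "'a ugraph \<Rightarrow> nat \<Rightarrow> 'a cover \<Rightarrow> bool" where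
  "is_fold_cover G m C \<longleftrightarrow> is_cover G C \<and> (\<forall>u\<in>verts G. card (cover_list C u) = m)"

definition is_full_fold_cover :: "'a ugraph \<Rightarrow> nat \<Rightarrow> 'a cover \<Rightarrow> bool" where
  "is_full_fold_cover G m C \<longleftrightarrow>
     is_fold_cover G m C \<and> (\<forall>e\<in>edges G. card (cover_matching C e) = m)"

definition cover_colorings :: "'a ugraph \<Rightarrow> 'a cover \<Rightarrow> ('a \<times> nat) set set" where
  "cover_colorings G C = {I. independent_set (cover_graph C) I \<and> card I = card (verts G)}"

text \<open>
  The least \<open>k\<close> is taken among positive integers: lists are nonempty, so a graph with a vertex
  has no 0-fold cover and \<open>k = 0\<close> would satisfy the condition vacuously.
\<close>

definition dp_chromatic_number :: "'a ugraph \<Rightarrow> nat" where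
  "dp_chromatic_number G =
     (LEAST k. 1 \<le> k \<and> (\<forall>C. is_fold_cover G k C \<longrightarrow> cover_colorings G C \<noteq> {}))"

text \<open>
  Meaningful for \<open>m \<ge> 1\<close>, where full \<open>m\<close>-fold covers exist.
\<close>

definition dp_color_function :: "'a ugraph \<Rightarrow> nat \<Rightarrow> nat" where
  "dp_color_function G m =
     (LEAST n. \<exists>C. is_full_fold_cover G m C \<and> n = card (cover_colorings G C))"

end

theory Submission
  imports Defs
begin

text \<open>
  The graphs are the generalized theta graph with end vertices 0 and 1 joined by two paths of
  length 2 and three paths of length 3, together with \<open>k\<close> isolated vertices.  A full
  \<open>m\<close>-fold cover is a choice of a bijection on each edge.  Once the colors of the two ends are
  fixed, the number of colorings is a product over the paths, and the factor of a path depends only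
  on whether its composed bijection matches the two end colors.

  For \<open>m = 3\<close> the factors are 2 (match) and 1 for length 2, and 2 (match) and 3 for length 3.  For
  each fixed color at 0, the sum over the color at 1 of the product of the five factors is least when
  all five matches coincide, where it is \<open>4 * 8 + 2 * 27 = 86\<close>; so the identity cover is optimal.
  For large \<open>m\<close>, twisting one edge of the 4-cycle by a cyclic shift gives fewer colorings.  For
  \<open>m \<le> 2\<close> the same twist leaves no coloring at all.
\<close>

section \<open>Covers as families of bijections between color lists\<close>

definition graph_of :: "'a set \<Rightarrow> ('a \<Rightarrow> nat) \<Rightarrow> ('a \<times> nat) set" where
  "graph_of V f = (\<lambda>v. (v, f v)) ` V"

text \<open>
  The bijection of an edge is only recorded for its increasing orientation: \<open>p u v\<close> with
  \<open>u < v\<close> sends a color at \<open>u\<close> to the color at \<open>v\<close> that it forbids.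
\<close>

definition twisted_colorings ::
    "'a::linorder ugraph \<Rightarrow> ('a \<Rightarrow> nat set) \<Rightarrow> ('a \<Rightarrow> 'a \<Rightarrow> nat \<Rightarrow> nat) \<Rightarrow> ('a \<Rightarrow> nat) set" where
  "twisted_colorings G A p =
     {f \<in> PiE (verts G) A. \<forall>u v. u < v \<longrightarrow> {u, v} \<in> edges G \<longrightarrow> f v \<noteq> p u v (f u)}"

definition twists ::
    "'a::linorder ugraph \<Rightarrow> nat \<Rightarrow> ('a \<Rightarrow> nat set) \<Rightarrow> ('a \<Rightarrow> 'a \<Rightarrow> nat \<Rightarrow> nat) \<Rightarrow> bool" where
  "twists G m A p \<longleftrightarrow>
     (\<forall>v\<in>verts G. finite (A v) \<and> card (A v) = m) \<and>
     (\<forall>u v. u < v \<longrightarrow> {u, v} \<in> edges G \<longrightarrow> bij_betw (p u v) (A u) (A v))"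

lemma finite_twisted_colorings:
  assumes "finite (verts G)" "\<And>v. v \<in> verts G \<Longrightarrow> finite (A v)"
  shows "finite (twisted_colorings G A p)"
  unfolding twisted_colorings_def
  by (rule finite_subset[OF _ finite_PiE[OF assms]]) auto

lemma inj_on_graph_of: "inj_on (graph_of V) (PiE V A)"
proof (rule inj_onI)
  fix f g assume f: "f \<in> PiE V A" and g: "g \<in> PiE V A" and eq: "graph_of V f = graph_of V g"
  have "f x = g x" if "x \<in> V" for x
  proof -
    have "(x, f x) \<in> graph_of V g"
      using that eq by (auto simp: graph_of_def)
    then show ?thesis by (auto simp: graph_of_def)
  qed
  with f g show "f = g" by (rule PiE_ext)
qed

text \<open>The partial map is kept on its domain \<open>D\<close>. The complements of
  \<open>D\<close> and of its image have equal size, so any bijection between them fills the gap.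
  This is how an arbitrary matching is enlarged to a perfect one.\<close>

lemma extend_partial_bijection:
  assumes fin: "finite A" "finite B" and card: "card A = card B"
    and r: "\<And>a b. r a b \<Longrightarrow> a \<in> A \<and> b \<in> B"
    and fn: "\<And>a b b'. r a b \<Longrightarrow> r a b' \<Longrightarrow> b = b'"
    and inj: "\<And>a a' b. r a b \<Longrightarrow> r a' b \<Longrightarrow> a = a'"
  obtains \<pi> where "bij_betw \<pi> A B" "\<And>a b. r a b \<Longrightarrow> b = \<pi> a"
proof -
  define D where "D = {a. \<exists>b. r a b}"
  define g where "g a = (THE b. r a b)" for a
  have g: "g a = b" if "r a b" for a b
    unfolding g_def using that fn by blast
  have DA: "D \<subseteq> A" and gB: "g ` D \<subseteq> B"
    using r g by (auto simp: D_def)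
  have injg: "inj_on g D"
    by (rule inj_onI) (use g inj in \<open>auto simp: D_def\<close>)
  have "card (A - D) = card (B - g ` D)"
    using fin DA gB injg card by (simp add: card_Diff_subset finite_subset card_image)
  then obtain h where h: "bij_betw h (A - D) (B - g ` D)"
    using fin by (metis finite_Diff finite_same_card_bij)
  define \<pi> where "\<pi> a = (if a \<in> D then g a else h a)" for a
  have "bij_betw \<pi> (D \<union> (A - D)) (g ` D \<union> (B - g ` D))"
  proof (rule bij_betw_combine)
    show "bij_betw \<pi> D (g ` D)"
      using injg by (auto simp: bij_betw_def inj_on_def \<pi>_def)
    show "bij_betw \<pi> (A - D) (B - g ` D)"
      using h by (subst bij_betw_cong[where g = h]) (auto simp: \<pi>_def)
  qed auto
  moreover have "D \<union> (A - D) = A" "g ` D \<union> (B - g ` D) = B"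
    using DA gB by auto
  ultimately have "bij_betw \<pi> A B" by simp
  moreover have "b = \<pi> a" if "r a b" for a b
    using that g by (auto simp: \<pi>_def D_def)
  ultimately show ?thesis by (rule that)
qed

lemma pairs_betweenI: "x \<in> A \<Longrightarrow> y \<in> B \<Longrightarrow> {x, y} \<in> pairs_between A B"
  unfolding pairs_between_def by blast

lemma pairs_between_commute: "pairs_between A B = pairs_between B A"
  unfolding pairs_between_def by (auto simp: insert_commute)

text \<open>Enlarging every matching to a perfect one can only forbid more pairs, so each coloring
  of the resulting twist gives a coloring of the cover. Partial matchings are covered too, as the
  DP-chromatic number requires.\<close>

lemma fold_cover_dominates_twist:
  fixes G :: "'a::linorder ugraph"
  assumes G: "finite_simple_graph G" and C: "is_fold_cover G m C"
  obtains A p where "twists G m A p"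
    "card (twisted_colorings G A p) \<le> card (cover_colorings G C)"
proof -
  define L where "L = cover_list C"
  define A where "A v = {a. (v, a) \<in> L v}" for v
  have cov: "is_cover G C" and card_L: "\<And>v. v \<in> verts G \<Longrightarrow> card (L v) = m"
    using C by (auto simp: is_fold_cover_def L_def)
  have L: "L v = Pair v ` A v" and finA: "finite (A v)" if "v \<in> verts G" for v
  proof -
    from cov have "\<forall>v\<in>verts G. \<exists>B. finite B \<and> B \<noteq> {} \<and> L v = {(v, a) | a. a \<in> B}"
      by (simp add: is_cover_def L_def)
    with that obtain B where "finite B" "L v = {(v, a) | a. a \<in> B}" by blast
    then show "L v = Pair v ` A v" "finite (A v)"
      by (auto simp: A_def)
  qed
  have cardA: "card (A v) = m" if "v \<in> verts G" for v
    using card_L[OF that] L[OF that] by (simp add: card_image inj_on_def)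
  have EV: "u \<in> verts G" "v \<in> verts G" if "{u, v} \<in> edges G" for u v
    using G that by (auto simp: finite_simple_graph_def)
  have M: "matching_between (L u) (L v) (cover_matching C {u, v})" if "{u, v} \<in> edges G" for u v
    using cov that by (auto simp: is_cover_def L_def)
  have H: "edges (cover_graph C) \<inter> pairs_between (L u) (L v) =
        (if {u, v} \<in> edges G then cover_matching C {u, v} else {})"
    if "u \<in> verts G" "v \<in> verts G" "u \<noteq> v" for u v
    using cov that by (auto simp: is_cover_def L_def)
  have ex: "\<exists>\<pi>. bij_betw \<pi> (A u) (A v) \<and>
      (\<forall>a b. {(u, a), (v, b)} \<in> cover_matching C {u, v} \<longrightarrow> b = \<pi> a)"
    if uv: "u < v" and e: "{u, v} \<in> edges G" for u v
  proof -
    let ?r = "\<lambda>a b. {(u, a), (v, b)} \<in> cover_matching C {u, v}"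
    have sub: "cover_matching C {u, v} \<subseteq> pairs_between (L u) (L v)"
      and dis: "pairwise disjnt (cover_matching C {u, v})"
      using M[OF e] by (auto simp: matching_between_def)
    show ?thesis
    proof (rule extend_partial_bijection[of "A u" "A v" ?r])
      show "finite (A u)" "finite (A v)" "card (A u) = card (A v)"
        using EV[OF e] finA cardA by auto
      show "a \<in> A u \<and> b \<in> A v" if "?r a b" for a b
        using subsetD[OF sub that] uv L[OF EV(1)[OF e]] L[OF EV(2)[OF e]]
        by (auto simp: pairs_between_def doubleton_eq_iff)
      \<comment> \<open>Distinct matching edges are disjoint, so the matching is single-valued in
        both directions.\<close>
      show "b = b'" if "?r a b" "?r a b'" for a b b'
        using pairwiseD[OF dis that] uv by (auto simp: disjnt_def doubleton_eq_iff)
      show "a = a'" if "?r a b" "?r a' b" for a a' b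
        using pairwiseD[OF dis that] uv by (auto simp: disjnt_def doubleton_eq_iff)
    next
      fix \<pi> assume "bij_betw \<pi> (A u) (A v)" "\<And>a b. ?r a b \<Longrightarrow> b = \<pi> a"
      then show ?thesis by blast
    qed
  qed
  define p where "p u v = (SOME \<pi>. bij_betw \<pi> (A u) (A v) \<and>
      (\<forall>a b. {(u, a), (v, b)} \<in> cover_matching C {u, v} \<longrightarrow> b = \<pi> a))" for u v
  have p: "bij_betw (p u v) (A u) (A v)"
      "\<And>a b. {(u, a), (v, b)} \<in> cover_matching C {u, v} \<Longrightarrow> b = p u v a"
    if "u < v" "{u, v} \<in> edges G" for u v
    using someI_ex[OF ex[OF that]] unfolding p_def by blast+
  have finV: "finite (verts G)" using G by (simp add: finite_simple_graph_def)
  have VH: "verts (cover_graph C) = (\<Union>v\<in>verts G. L v)"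
    and finH: "finite (verts (cover_graph C))"
    and EH: "\<And>e. e \<in> edges (cover_graph C) \<Longrightarrow> card e = 2"
    using cov by (auto simp: is_cover_def L_def finite_simple_graph_def)
  have "graph_of (verts G) f \<in> cover_colorings G C" if f: "f \<in> twisted_colorings G A p" for f
  proof -
    have fA: "f v \<in> A v" if "v \<in> verts G" for v
      using f that by (auto simp: twisted_colorings_def)
    \<comment> \<open>An edge of the cover graph between two lists belongs to the matching, and the
      chosen bijection forbids every matched pair.\<close>
    have no_edge: "{(u, f u), (v, f v)} \<notin> edges (cover_graph C)"
      if "u \<in> verts G" "v \<in> verts G" "u < v" for u v
    proof
      assume "{(u, f u), (v, f v)} \<in> edges (cover_graph C)"
      moreover have "{(u, f u), (v, f v)} \<in> pairs_between (L u) (L v)"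
        using that fA L by (intro pairs_betweenI) auto
      ultimately have "{u, v} \<in> edges G \<and> {(u, f u), (v, f v)} \<in> cover_matching C {u, v}"
        using H[of u v] that by (metis IntI empty_iff less_imp_neq)
      then have "{u, v} \<in> edges G" "f v = p u v (f u)"
        using p(2)[of u v] that by auto
      then show False using f that by (auto simp: twisted_colorings_def)
    qed
    have "{(u, f u), (v, f v)} \<notin> edges (cover_graph C)"
      if "u \<in> verts G" "v \<in> verts G" for u v
    proof (cases u v rule: linorder_cases)
      case less
      then show ?thesis using no_edge that by blast
    next
      case equal
      \<comment> \<open>The pair collapses to a singleton, while edges have two elements.\<close>
      then show ?thesis using EH[of "{(u, f u)}"] by auto
    next
      case greater
      then show ?thesis using no_edge[of v u] that by (simp add: insert_commute)
    qed
    moreover have "card (graph_of (verts G) f) = card (verts G)"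
      by (simp add: graph_of_def card_image inj_on_def)
    ultimately show ?thesis
      using fA L VH by (auto simp: cover_colorings_def independent_set_def graph_of_def)
  qed
  moreover have "finite (cover_colorings G C)"
    by (rule finite_subset[of _ "Pow (verts (cover_graph C))"])
      (use finH in \<open>auto simp: cover_colorings_def independent_set_def\<close>)
  moreover have "inj_on (graph_of (verts G)) (twisted_colorings G A p)"
    by (rule inj_on_subset[OF inj_on_graph_of]) (auto simp: twisted_colorings_def)
  ultimately have "card (twisted_colorings G A p) \<le> card (cover_colorings G C)"
    by (intro card_inj_on_le) auto
  moreover have "twists G m A p"
    using finA cardA p by (auto simp: twists_def)
  ultimately show ?thesis by (intro that)
qed

section \<open>Full covers built from families of bijections\<close>

definition twisted_matching ::
    "nat \<Rightarrow> ('a::linorder \<Rightarrow> 'a \<Rightarrow> nat \<Rightarrow> nat) \<Rightarrow> 'a set \<Rightarrow> ('a \<times> nat) set set" where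
  "twisted_matching m p e = {{(u, a), (v, p u v a)} | u v a. u < v \<and> e = {u, v} \<and> a < m}"

definition twisted_cover ::
    "'a::linorder ugraph \<Rightarrow> nat \<Rightarrow> ('a \<Rightarrow> 'a \<Rightarrow> nat \<Rightarrow> nat) \<Rightarrow> 'a cover" where
  "twisted_cover G m p =
     \<lparr>cover_list = \<lambda>v. Pair v ` {..<m},
      cover_graph =
        \<lparr>verts = verts G \<times> {..<m},
         edges = {{(v, a), (v, b)} | v a b. v \<in> verts G \<and> a < m \<and> b < m \<and> a \<noteq> b} \<union>
                 (\<Union>e\<in>edges G. twisted_matching m p e)\<rparr>,
      cover_matching = twisted_matching m p\<rparr>"

lemma twisted_matching_pair:
  assumes "u < v"
  shows "twisted_matching m p {u, v} = (\<lambda>a. {(u, a), (v, p u v a)}) ` {..<m}"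
  using assms unfolding twisted_matching_def
  by (fastforce simp: doubleton_eq_iff)

lemma edge_cases:
  fixes G :: "'a::linorder ugraph"
  assumes "finite_simple_graph G" "e \<in> edges G"
  obtains u v where "u < v" "e = {u, v}" "u \<in> verts G" "v \<in> verts G"
proof -
  from assms have "card e = 2" "e \<subseteq> verts G" by (auto simp: finite_simple_graph_def)
  then obtain x y where "e = {x, y}" "x \<noteq> y" by (auto simp: card_2_iff)
  with \<open>e \<subseteq> verts G\<close> that[of x y] that[of y x] show ?thesis
    by (cases x y rule: linorder_cases) (auto simp: insert_commute)
qed

lemma matching_between_commute: "matching_between A B F = matching_between B A F"
  unfolding matching_between_def by (simp add: pairs_between_commute)

text \<open>Bijectivity of \<open>p u v\<close> makes the cross edges over an edge of
  \<open>G\<close> disjoint and \<open>m\<close> in number; \<open>m \<ge> 1\<close> keeps the lists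
  nonempty. Such covers are the witnesses for all upper bounds on the DP color function.\<close>

lemma twisted_cover_full:
  fixes G :: "'a::linorder ugraph"
  assumes G: "finite_simple_graph G" and m: "m \<ge> 1" and p: "twists G m (\<lambda>_. {..<m}) p"
  shows "is_full_fold_cover G m (twisted_cover G m p)"
proof -
  let ?L = "\<lambda>v::'a. Pair v ` {..<m}"
  let ?C = "twisted_cover G m p"
  have bij: "bij_betw (p u v) {..<m} {..<m}" if "u < v" "{u, v} \<in> edges G" for u v
    using p that by (auto simp: twists_def)
  have plt: "p u v a < m" if "u < v" "{u, v} \<in> edges G" "a < m" for u v a
    using bij_betwE[OF bij[OF that(1,2)]] that(3) by auto
  have pinj: "a = b" if "p u v a = p u v b" "u < v" "{u, v} \<in> edges G" "a < m" "b < m" for u v a b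
    using bij_betw_imp_inj_on[OF bij[OF that(2,3)]] that by (auto simp: inj_on_def)
  have match_less: "matching_between (?L u) (?L v) (twisted_matching m p {u, v})"
    if "u < v" "{u, v} \<in> edges G" for u v
    unfolding matching_between_def twisted_matching_pair[OF that(1)]
  proof
    show "(\<lambda>a. {(u, a), (v, p u v a)}) ` {..<m} \<subseteq> pairs_between (?L u) (?L v)"
      using plt[OF that] by (auto intro!: pairs_betweenI)
    show "pairwise disjnt ((\<lambda>a. {(u, a), (v, p u v a)}) ` {..<m})"
    proof (rule pairwiseI)
      fix x y assume "x \<in> (\<lambda>a. {(u, a), (v, p u v a)}) ` {..<m}"
        "y \<in> (\<lambda>a. {(u, a), (v, p u v a)}) ` {..<m}" "x \<noteq> y"
      then obtain a b where ab: "a < m" "b < m" "x = {(u, a), (v, p u v a)}" "y = {(u, b), (v, p u v b)}"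
        by blast
      with \<open>x \<noteq> y\<close> have "a \<noteq> b" by auto
      then have "p u v a \<noteq> p u v b" using pinj[OF _ that] ab by blast
      with \<open>a \<noteq> b\<close> ab \<open>u < v\<close> show "disjnt x y" by (auto simp: disjnt_def)
    qed
  qed
  have match: "matching_between (?L u) (?L v) (twisted_matching m p {u, v})"
    if e: "{u, v} \<in> edges G" for u v
  proof (cases u v rule: linorder_cases)
    case less then show ?thesis using match_less e by blast
  next
    case equal then show ?thesis using G e by (auto simp: finite_simple_graph_def)
  next
    case greater
    then show ?thesis using match_less[of v u] e
      by (metis insert_commute matching_between_commute)
  qed
  have between_less: "edges (cover_graph ?C) \<inter> pairs_between (?L u) (?L v) =
        (if {u, v} \<in> edges G then twisted_matching m p {u, v} else {})"
    if "u < v" for u v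
  proof -
    have "x \<in> twisted_matching m p {u, v} \<and> {u, v} \<in> edges G"
      if x: "x \<in> edges (cover_graph ?C)" "x \<in> pairs_between (?L u) (?L v)" for x
    proof -
      from x(2) obtain a b where ab: "x = {(u, a), (v, b)}" "a < m" "b < m"
        by (auto simp: pairs_between_def)
      \<comment> \<open>The ends of \<open>x\<close> lie over different vertices, so
        \<open>x\<close> is no clique edge and comes from some matching. The first components of its
        ends then tell which one.\<close>
      from x(1) ab(1) \<open>u < v\<close> obtain e where e: "e \<in> edges G" "x \<in> twisted_matching m p e"
        by (auto simp: twisted_cover_def doubleton_eq_iff)
      from e(2) obtain u' v' c where "e = {u', v'}" "x = {(u', c), (v', p u' v' c)}"
        by (auto simp: twisted_matching_def)
      with ab(1) have "e = {u, v}" by (auto simp: doubleton_eq_iff)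
      with e show ?thesis by simp
    qed
    moreover have "x \<in> edges (cover_graph ?C) \<and> x \<in> pairs_between (?L u) (?L v)"
      if "x \<in> twisted_matching m p {u, v}" "{u, v} \<in> edges G" for x
      using match[OF that(2)] that by (auto simp: matching_between_def twisted_cover_def)
    ultimately show ?thesis by auto
  qed
  have between: "edges (cover_graph ?C) \<inter> pairs_between (?L u) (?L v) =
        (if {u, v} \<in> edges G then twisted_matching m p {u, v} else {})"
    if "u \<noteq> v" for u v
  proof (cases u v rule: linorder_cases)
    case less then show ?thesis by (rule between_less)
  next
    case equal with that show ?thesis by simp
  next
    case greater
    then show ?thesis using between_less[of v u]
      by (simp only: insert_commute[of u v] pairs_between_commute[of "?L u"])
  qed
  have fin: "finite_simple_graph (cover_graph ?C)"
    unfolding finite_simple_graph_def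
  proof (intro conjI ballI)
    show "finite (verts (cover_graph ?C))"
      using G by (simp add: twisted_cover_def finite_simple_graph_def)
    fix x assume "x \<in> edges (cover_graph ?C)"
    then consider (clique) v a b where "v \<in> verts G" "a < m" "b < m" "a \<noteq> b" "x = {(v, a), (v, b)}"
      | (cross) e where "e \<in> edges G" "x \<in> twisted_matching m p e"
      by (auto simp: twisted_cover_def)
    then have "x \<subseteq> verts (cover_graph ?C) \<and> card x = 2"
    proof cases
      case clique
      then show ?thesis by (auto simp: twisted_cover_def)
    next
      case cross
      obtain u v where uv: "u < v" "e = {u, v}" "u \<in> verts G" "v \<in> verts G"
        using edge_cases[OF G cross(1)] .
      then obtain a where "a < m" "x = {(u, a), (v, p u v a)}"
        using cross(2) twisted_matching_pair[of u v] by auto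
      moreover have "p u v a < m"
        using plt[OF uv(1) _ \<open>a < m\<close>] cross(1) uv(2) by simp
      ultimately show ?thesis
        using uv less_imp_neq[OF uv(1)] by (simp add: twisted_cover_def)
    qed
    then show "x \<subseteq> verts (cover_graph ?C)" "card x = 2" by auto
  qed
  have "is_cover G ?C"
    unfolding is_cover_def
  proof (intro conjI ballI allI impI)
    show "\<exists>A. finite A \<and> A \<noteq> {} \<and> cover_list ?C v = {(v, a) | a. a \<in> A}" for v
      using m by (intro exI[of _ "{..<m}"]) (auto simp: twisted_cover_def lessThan_empty_iff)
    show "finite_simple_graph (cover_graph ?C)" by (rule fin)
    show "verts (cover_graph ?C) = (\<Union>v\<in>verts G. cover_list ?C v)"
      by (auto simp: twisted_cover_def)
    show "matching_between (cover_list ?C u) (cover_list ?C v) (cover_matching ?C {u, v})"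
      if "{u, v} \<in> edges G" for u v
      using match[OF that] by (simp add: twisted_cover_def)
    show "complete_graph (induced_subgraph (cover_graph ?C) (cover_list ?C u))"
      if "u \<in> verts G" for u
      using that by (auto simp: complete_graph_def induced_subgraph_def twisted_cover_def)
    show "edges (cover_graph ?C) \<inter> pairs_between (cover_list ?C u) (cover_list ?C v) =
        (if {u, v} \<in> edges G then cover_matching ?C {u, v} else {})"
      if "u \<noteq> v" for u v
      using between[OF that] by (simp add: twisted_cover_def)
  qed
  moreover have "card (cover_list ?C u) = m" for u
  proof -
    have "inj_on (Pair u) {..<m}" by (simp add: inj_on_def)
    then show ?thesis by (simp add: twisted_cover_def card_image)
  qed
  moreover have "card (cover_matching ?C e) = m" if "e \<in> edges G" for e
  proof -
    obtain u v where uv: "u < v" "e = {u, v}"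
      by (rule edge_cases[OF G \<open>e \<in> edges G\<close>])
    have "inj_on (\<lambda>a. {(u, a), (v, p u v a)}) {..<m}"
    proof (rule inj_onI)
      fix a b assume "{(u, a), (v, p u v a)} = {(u, b), (v, p u v b)}"
      then show "a = b" using less_imp_neq[OF uv(1)] by (simp add: doubleton_eq_iff)
    qed
    then show ?thesis
      unfolding uv(2) by (simp add: twisted_cover_def twisted_matching_pair[OF uv(1)] card_image)
  qed
  ultimately show ?thesis by (simp add: is_full_fold_cover_def is_fold_cover_def)
qed

text \<open>Every list is a clique, so an independent set meets it at most once; having
  \<open>card (verts G)\<close> elements, it meets every list exactly once and is the graph of a
  color choice.\<close>

lemma twisted_cover_colorings:
  fixes G :: "'a::linorder ugraph"
  assumes G: "finite_simple_graph G"
  shows "cover_colorings G (twisted_cover G m p)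
           \<subseteq> graph_of (verts G) ` twisted_colorings G (\<lambda>_. {..<m}) p"
proof
  let ?H = "cover_graph (twisted_cover G m p)"
  fix I assume "I \<in> cover_colorings G (twisted_cover G m p)"
  then have IV: "I \<subseteq> verts G \<times> {..<m}" and ind: "\<And>x y. x \<in> I \<Longrightarrow> y \<in> I \<Longrightarrow> {x, y} \<notin> edges ?H"
    and card: "card I = card (verts G)"
    by (auto simp: cover_colorings_def independent_set_def twisted_cover_def)
  have finV: "finite (verts G)" using G by (simp add: finite_simple_graph_def)
  have inj: "inj_on fst I"
  proof (rule inj_onI)
    fix x y assume xy: "x \<in> I" "y \<in> I" "fst x = fst y"
    obtain v a b where [simp]: "x = (v, a)" "y = (v, b)"
      using xy(3) by (metis prod.collapse)
    show "x = y"
    proof (rule ccontr)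
      assume "x \<noteq> y"
      moreover have "v \<in> verts G" "a < m" "b < m" using xy(1,2) IV by auto
      ultimately have "{(v, a), (v, b)} \<in> edges ?H"
        unfolding twisted_cover_def by simp blast
      with ind[OF xy(1,2)] show False by simp
    qed
  qed
  have fstI: "fst ` I = verts G"
  proof (rule card_subset_eq)
    show "finite (verts G)" by (rule finV)
    show "fst ` I \<subseteq> verts G" using IV by auto
    show "card (fst ` I) = card (verts G)" using card card_image[OF inj] by simp
  qed
  define f where "f = restrict (\<lambda>v. SOME a. (v, a) \<in> I) (verts G)"
  have f: "(v, f v) \<in> I" if "v \<in> verts G" for v
  proof -
    have "\<exists>a. (v, a) \<in> I" using that fstI by force
    then have "(v, SOME a. (v, a) \<in> I) \<in> I" by (rule someI_ex)
    then show ?thesis using that by (simp add: f_def)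
  qed
  have "I = graph_of (verts G) f"
  proof
    show "graph_of (verts G) f \<subseteq> I" using f by (auto simp: graph_of_def)
    show "I \<subseteq> graph_of (verts G) f"
    proof
      fix x assume x: "x \<in> I"
      then have v: "fst x \<in> verts G" using fstI by auto
      then have "x = (fst x, f (fst x))"
        using inj_onD[OF inj, of x "(fst x, f (fst x))"] x f by simp
      with v show "x \<in> graph_of (verts G) f" by (auto simp: graph_of_def)
    qed
  qed
  moreover have "f \<in> twisted_colorings G (\<lambda>_. {..<m}) p"
    unfolding twisted_colorings_def
  proof (intro CollectI conjI allI impI)
    show "f \<in> (\<Pi>\<^sub>E v\<in>verts G. {..<m})"
    proof (rule PiE_I)
      show "f v \<in> {..<m}" if "v \<in> verts G" for v using f[OF that] IV by auto
      show "f v = undefined" if "v \<notin> verts G" for v using that by (simp add: f_def)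
    qed
    fix u v assume uv: "u < v" "{u, v} \<in> edges G"
    then have V: "u \<in> verts G" "v \<in> verts G" using G by (auto simp: finite_simple_graph_def)
    then have lt: "f u < m" using f IV by auto
    \<comment> \<open>If \<open>f v\<close> were the forbidden color, this cross edge would join two
      members of \<open>I\<close>.\<close>
    have "{(u, f u), (v, p u v (f u))} \<in> twisted_matching m p {u, v}"
      using uv lt by (simp add: twisted_matching_pair)
    then have "{(u, f u), (v, p u v (f u))} \<in> edges ?H"
      using uv(2) unfolding twisted_cover_def by simp blast
    then show "f v \<noteq> p u v (f u)"
      using ind[OF f[OF V(1)] f[OF V(2)]] by auto
  qed
  ultimately show "I \<in> graph_of (verts G) ` twisted_colorings G (\<lambda>_. {..<m}) p" by blast
qed


section \<open>Counting colorings of the theta graphs path by path\<close>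

lemma sum_PiE_insert:
  assumes "x \<notin> S"
  shows "(\<Sum>f\<in>PiE (insert x S) A. F f) = (\<Sum>c\<in>A x. \<Sum>g\<in>PiE S A. F (g(x := c)))"
  unfolding PiE_insert_eq sum.reindex[OF inj_combinator[OF assms]]
  by (simp add: sum.cartesian_product case_prod_unfold)

text \<open>The inner vertices of the five paths from 0 to 1 are 2; 3; 4, 5; 6, 7; and 8, 9. Every
  arc is increasing, the orientation in which twists are recorded, so the last arc of each path
  starts at 1.\<close>

definition theta_arcs :: "(nat \<times> nat) set" where
  "theta_arcs = {(0,2), (1,2), (0,3), (1,3), (0,4), (4,5), (1,5), (0,6), (6,7), (1,7), (0,8), (8,9), (1,9)}"

text \<open>The \<open>k\<close> isolated vertices multiply every count by \<open>m ^ k\<close> and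
  keep the graphs pairwise non-isomorphic.\<close>

definition theta_graph :: "nat \<Rightarrow> nat ugraph" where
  "theta_graph k = \<lparr>verts = {..<10 + k}, edges = (\<lambda>(u, v). {u, v}) ` theta_arcs\<rparr>"

text \<open>The number of colors left for the inner vertex of a path of length 2; \<open>eq\<close>
  states that both ends forbid the same color there.\<close>

definition path2_weight :: "nat \<Rightarrow> bool \<Rightarrow> nat" where
  "path2_weight m eq = (if eq then m - 1 else m - 2)"

text \<open>The number of colorings of the two inner vertices of a path of length 3;
  \<open>eq\<close> states that the middle bijection sends the color forbidden at the first to the
  color forbidden at the second. For \<open>m \<ge> 2\<close> a match costs exactly one
  coloring.\<close>

definition path3_weight :: "nat \<Rightarrow> bool \<Rightarrow> nat" where
  "path3_weight m eq = (if eq then (m - 1) * (m - 2) else (m - 2) * (m - 2) + (m - 1))"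

lemma finite_simple_theta: "finite_simple_graph (theta_graph k)"
  by (auto simp: finite_simple_graph_def theta_graph_def theta_arcs_def)

lemma theta_arcs_less: "(u, v) \<in> theta_arcs \<Longrightarrow> u < v"
  by (auto simp: theta_arcs_def)

lemma theta_edge_iff: "u < v \<Longrightarrow> {u, v} \<in> edges (theta_graph k) \<longleftrightarrow> (u, v) \<in> theta_arcs"
proof -
  assume "u < v"
  then show ?thesis
    by (fastforce simp: theta_graph_def doubleton_eq_iff dest: theta_arcs_less)
qed

lemma theta_twistsD:
  assumes "twists (theta_graph k) m A p"
  shows "v < 10 + k \<Longrightarrow> finite (A v)" "v < 10 + k \<Longrightarrow> card (A v) = m"
    "(u, v) \<in> theta_arcs \<Longrightarrow> bij_betw (p u v) (A u) (A v)"
  using assms theta_arcs_less[of u v] theta_edge_iff[of u v k]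
  by (auto simp: twists_def theta_graph_def)

lemma path2_count:
  assumes "finite X" "card X = m" "a \<in> X" "b \<in> X"
  shows "(\<Sum>c\<in>X. of_bool (c \<noteq> a) * of_bool (c \<noteq> b)) = path2_weight m (a = b)"
proof -
  have "(\<Sum>c\<in>X. of_bool (c \<noteq> a) * of_bool (c \<noteq> b)) = (\<Sum>c\<in>X - {a, b}. (1::nat))"
    using assms by (intro sum.mono_neutral_cong_right) auto
  also have "\<dots> = path2_weight m (a = b)"
    using assms by (auto simp: path2_weight_def card_Diff_subset)
  finally show ?thesis .
qed

text \<open>Once \<open>c\<close> is fixed, the choices of \<open>d\<close> are counted as for a
  path of length 2 whose ends forbid \<open>\<pi> c\<close> and \<open>b\<close>.\<close>

lemma path3_count:
  assumes X: "finite X" "card X = m" "a \<in> X" and Y: "finite Y" "card Y = m" "b \<in> Y"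
    and \<pi>: "bij_betw \<pi> X Y"
  shows "(\<Sum>c\<in>X. \<Sum>d\<in>Y. of_bool (c \<noteq> a) * (of_bool (d \<noteq> \<pi> c) * of_bool (d \<noteq> b)))
    = path3_weight m (\<pi> a = b)"
proof -
  have "(\<Sum>c\<in>X. \<Sum>d\<in>Y. of_bool (c \<noteq> a) * (of_bool (d \<noteq> \<pi> c) * of_bool (d \<noteq> b)))
      = (\<Sum>c\<in>X. of_bool (c \<noteq> a) * path2_weight m (\<pi> c = b))"
    unfolding sum_distrib_left[symmetric]
    using path2_count[OF Y(1,2) bij_betwE[OF \<pi>, rule_format] Y(3)] by (intro sum.cong) auto
  also have "\<dots> = (\<Sum>c\<in>X - {a}. path2_weight m (\<pi> c = b))"
    using X by (intro sum.mono_neutral_cong_right) auto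
  also have "\<dots> = path3_weight m (\<pi> a = b)"
  proof -
    \<comment> \<open>Only \<open>c = t\<close> leaves \<open>m - 1\<close> choices for
      \<open>d\<close>; every other \<open>c\<close> leaves \<open>m - 2\<close>. The weight thus
      depends on whether \<open>t\<close> is the excluded color \<open>a\<close>.\<close>
    obtain t where t: "t \<in> X" "\<pi> t = b"
      using \<pi> Y(3) by (auto simp: bij_betw_def)
    then have eq: "\<pi> c = b \<longleftrightarrow> c = t" if "c \<in> X" for c
      using \<pi> that by (auto simp: bij_betw_def inj_on_def)
    have "(\<Sum>c\<in>X - {a}. path2_weight m (\<pi> c = b)) = (\<Sum>c\<in>X - {a}. path2_weight m (c = t))"
      using eq by (intro sum.cong) auto
    also have "\<dots> = path3_weight m (a = t)"
    proof (cases "a = t")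
      case True
      have "(\<Sum>c\<in>X - {a}. path2_weight m (c = t)) = (\<Sum>c\<in>X - {a}. m - 2)"
        using True by (intro sum.cong) (auto simp: path2_weight_def)
      with True X show ?thesis by (simp add: path3_weight_def)
    next
      case False
      have "(\<Sum>c\<in>X - {a}. path2_weight m (c = t))
          = (m - 1) + (\<Sum>c\<in>X - {a} - {t}. path2_weight m (c = t))"
        using X False t by (subst sum.remove[of _ t]) (auto simp: path2_weight_def)
      also have "(\<Sum>c\<in>X - {a} - {t}. path2_weight m (c = t)) = (\<Sum>c\<in>X - {a} - {t}. m - 2)"
        by (intro sum.cong) (auto simp: path2_weight_def)
      also have "\<dots> = (m - 2) * (m - 2)"
        using X False t by (simp add: card_Diff_singleton_if numeral_2_eq_2)
      finally show ?thesis using False by (simp add: path3_weight_def)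
    qed
    finally show ?thesis using eq[OF X(3)] by simp
  qed
  finally show ?thesis .
qed

lemma theta_verts:
  "{..<10 + k} = insert 0 (insert 1 (insert 2 (insert 3 (insert 4 (insert 5 (insert 6
    (insert 7 (insert 8 (insert 9 {10..<10 + k :: nat})))))))))"
  by auto

text \<open>With the colors \<open>a\<close> and \<open>b\<close> of the ends fixed, the paths are
  colored independently of each other, and each isolated vertex contributes a factor
  \<open>m\<close>.\<close>

lemma card_theta_colorings:
  assumes tw: "twists (theta_graph k) m A p"
  shows "card (twisted_colorings (theta_graph k) A p) =
    m ^ k * (\<Sum>a\<in>A 0. \<Sum>b\<in>A 1.
      path2_weight m (p 0 2 a = p 1 2 b) * (path2_weight m (p 0 3 a = p 1 3 b) *
      (path3_weight m (p 4 5 (p 0 4 a) = p 1 5 b) * (path3_weight m (p 6 7 (p 0 6 a) = p 1 7 b) *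
       path3_weight m (p 8 9 (p 0 8 a) = p 1 9 b)))))"
proof -
  note A = theta_twistsD(1,2)[OF tw] and p = theta_twistsD(3)[OF tw]
  have pA: "p u v a \<in> A v" if "a \<in> A u" "(u, v) \<in> theta_arcs" for u v a
    using bij_betwE[OF p[OF that(2)]] that(1) by blast
  let ?w2 = "\<lambda>u a b. \<Sum>c\<in>A u. of_bool (c \<noteq> p 0 u a) * of_bool (c \<noteq> p 1 u b) :: nat"
  let ?w3 = "\<lambda>u v a b. \<Sum>c\<in>A u. \<Sum>d\<in>A v.
      of_bool (c \<noteq> p 0 u a) * (of_bool (d \<noteq> p u v c) * of_bool (d \<noteq> p 1 v b)) :: nat"
  have w2: "?w2 u a b = path2_weight m (p 0 u a = p 1 u b)"
    if "a \<in> A 0" "b \<in> A 1" "(0, u) \<in> theta_arcs" "(1, u) \<in> theta_arcs" "u < 10 + k" for u a b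
    using A[OF that(5)] that pA by (intro path2_count) auto
  have w3: "?w3 u v a b = path3_weight m (p u v (p 0 u a) = p 1 v b)"
    if "a \<in> A 0" "b \<in> A 1" "(0, u) \<in> theta_arcs" "(1, v) \<in> theta_arcs" "(u, v) \<in> theta_arcs"
      "u < 10 + k" "v < 10 + k" for u v a b
    using A[OF that(6)] A[OF that(7)] that p pA by (intro path3_count) auto
  have "twisted_colorings (theta_graph k) A p =
      {f \<in> PiE {..<10 + k} A. \<forall>(u, v) \<in> theta_arcs. f v \<noteq> p u v (f u)}"
  proof -
    have "(\<forall>u v. u < v \<longrightarrow> {u, v} \<in> edges (theta_graph k) \<longrightarrow> f v \<noteq> p u v (f u)) \<longleftrightarrow>
        (\<forall>(u, v) \<in> theta_arcs. f v \<noteq> p u v (f u))" for f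
      using theta_edge_iff theta_arcs_less by blast
    then show ?thesis by (simp add: twisted_colorings_def theta_graph_def)
  qed
  then have "card (twisted_colorings (theta_graph k) A p) =
      (\<Sum>f\<in>PiE {..<10 + k} A. of_bool (\<forall>(u, v) \<in> theta_arcs. f v \<noteq> p u v (f u)))"
  proof -
    have "finite (PiE {..<10 + k} A)" by (rule finite_PiE) (auto simp: A)
    then show ?thesis using \<open>twisted_colorings (theta_graph k) A p = _\<close> by (simp add: Int_def)
  qed
  also have "\<dots> = (\<Sum>a\<in>A 0. \<Sum>b\<in>A 1. \<Sum>c2\<in>A 2. \<Sum>c3\<in>A 3. \<Sum>c4\<in>A 4. \<Sum>c5\<in>A 5. \<Sum>c6\<in>A 6.
      \<Sum>c7\<in>A 7. \<Sum>c8\<in>A 8. \<Sum>c9\<in>A 9. 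
        (of_bool (c2 \<noteq> p 0 2 a) * of_bool (c2 \<noteq> p 1 2 b)) *
        ((of_bool (c3 \<noteq> p 0 3 a) * of_bool (c3 \<noteq> p 1 3 b)) *
        ((of_bool (c4 \<noteq> p 0 4 a) * (of_bool (c5 \<noteq> p 4 5 c4) * of_bool (c5 \<noteq> p 1 5 b))) *
        ((of_bool (c6 \<noteq> p 0 6 a) * (of_bool (c7 \<noteq> p 6 7 c6) * of_bool (c7 \<noteq> p 1 7 b))) *
        ((of_bool (c8 \<noteq> p 0 8 a) * (of_bool (c9 \<noteq> p 8 9 c8) * of_bool (c9 \<noteq> p 1 9 b))) *
         (\<Sum>f\<in>PiE {10..<10 + k} A. 1))))))"
    unfolding theta_verts
    \<comment> \<open>The ten vertices of the theta graph are peeled off one at a time; the isolated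
      vertices remain as the innermost sum.\<close>
    apply (subst sum_PiE_insert, simp)+
    apply (simp only: sum_distrib_left)
    apply (intro sum.cong refl)
    apply (simp add: theta_arcs_def of_bool_conj)
    done
  \<comment> \<open>Each inner color occurs in the factors of a single path, so the iterated sum
    splits into a product.\<close>
  also have "\<dots> = (\<Sum>a\<in>A 0. \<Sum>b\<in>A 1. ?w2 2 a b * (?w2 3 a b * (?w3 4 5 a b *
      (?w3 6 7 a b * (?w3 8 9 a b * (\<Sum>f\<in>PiE {10..<10 + k} A. 1))))))"
    by (simp only: sum_distrib_left[symmetric] sum_distrib_right[symmetric])
  also have "(\<Sum>f\<in>PiE {10..<10 + k} A. 1) = m ^ k"
    using A by (simp add: card_PiE)
  also have "(\<Sum>a\<in>A 0. \<Sum>b\<in>A 1. ?w2 2 a b * (?w2 3 a b * (?w3 4 5 a b *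
      (?w3 6 7 a b * (?w3 8 9 a b * m ^ k))))) = (\<Sum>a\<in>A 0. \<Sum>b\<in>A 1.
      path2_weight m (p 0 2 a = p 1 2 b) * (path2_weight m (p 0 3 a = p 1 3 b) *
      (path3_weight m (p 4 5 (p 0 4 a) = p 1 5 b) * (path3_weight m (p 6 7 (p 0 6 a) = p 1 7 b) *
       (path3_weight m (p 8 9 (p 0 8 a) = p 1 9 b) * m ^ k)))))"
    by (intro sum.cong refl arg_cong2[where f = "(*)"] w2 w3) (auto simp: theta_arcs_def)
  finally show ?thesis
    by (simp add: sum_distrib_left mult_ac)
qed

section \<open>Sums over the color at one end, and the lower bound for three colors\<close>

lemma sum_two_values:
  assumes "finite B" "t \<in> B"
  shows "(\<Sum>b\<in>B. if b = t then x else y) = x + (card B - 1) * (y::nat)"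
proof -
  have "(\<Sum>b\<in>B - {t}. if b = t then x else y) = (\<Sum>b\<in>B - {t}. y)"
    by (intro sum.cong) auto
  then show ?thesis using assms by (simp add: sum.remove[of B t])
qed

lemma sum_three_values:
  assumes "finite B" "s \<in> B" "t \<in> B" "s \<noteq> t"
  shows "(\<Sum>b\<in>B. if b = s then x else if b = t then y else z) = x + y + (card B - 2) * (z::nat)"
proof -
  have "(\<Sum>b\<in>B - {s}. if b = s then x else if b = t then y else z)
      = (\<Sum>b\<in>B - {s}. if b = t then y else z)"
    by (intro sum.cong) auto
  also have "\<dots> = y + (card (B - {s}) - 1) * z"
    using assms by (intro sum_two_values) auto
  finally show ?thesis using assms by (simp add: sum.remove[of B s] numeral_2_eq_2)
qed

text \<open>Each of the five matches falls on one of three colors, which leaves \<open>3 ^ 5\<close>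
  configurations; all are evaluated. The value 86 is attained when the five coincide.\<close>

lemma theta_row_bound:
  assumes "card X = 3" "s \<in> X" "t \<in> X" "x \<in> X" "y \<in> X" "z \<in> X"
  shows "86 \<le> (\<Sum>b\<in>X. path2_weight 3 (b = s) * (path2_weight 3 (b = t) *
    (path3_weight 3 (b = x) * (path3_weight 3 (b = y) * path3_weight 3 (b = z)))))"
proof -
  obtain i j k where X: "X = {i, j, k}" and d: "i \<noteq> j" "i \<noteq> k" "j \<noteq> k"
    using assms(1) by (auto simp: card_3_iff)
  note [simp] = d d[symmetric] path2_weight_def path3_weight_def
  show ?thesis using assms(2-) unfolding X by (elim insertE emptyE; simp)
qed

lemma theta_colorings_lower:
  assumes tw: "twists (theta_graph k) 3 A p"
  shows "258 * 3 ^ k \<le> card (twisted_colorings (theta_graph k) A p)"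
proof -
  note A = theta_twistsD(1,2)[OF tw] and p = theta_twistsD(3)[OF tw]
  have pA: "p u v a \<in> A v" if "a \<in> A u" "(u, v) \<in> theta_arcs" for u v a
    using bij_betwE[OF p[OF that(2)]] that(1) by blast
  \<comment> \<open>For a fixed color at 0, bijectivity on the last arc of a path yields exactly one
    color at 1 that matches along that path.\<close>
  have inv: "\<exists>t\<in>A u. \<forall>b\<in>A u. c = p u v b \<longleftrightarrow> b = t" if uv: "(u, v) \<in> theta_arcs" and c: "c \<in> A v" for u v c
  proof -
    have inj: "inj_on (p u v) (A u)" and "p u v ` A u = A v"
      using p[OF uv] by (auto simp: bij_betw_def)
    then obtain t where t: "t \<in> A u" "c = p u v t" using c by blast
    then show ?thesis using inj_on_eq_iff[OF inj] by blast
  qed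
  let ?F = "\<lambda>a b.
      path2_weight 3 (p 0 2 a = p 1 2 b) * (path2_weight 3 (p 0 3 a = p 1 3 b) *
      (path3_weight 3 (p 4 5 (p 0 4 a) = p 1 5 b) * (path3_weight 3 (p 6 7 (p 0 6 a) = p 1 7 b) *
       path3_weight 3 (p 8 9 (p 0 8 a) = p 1 9 b))))"
  have row: "86 \<le> sum (?F a) (A 1)" if a: "a \<in> A 0" for a
  proof -
    obtain s where s: "s \<in> A 1" "\<forall>b\<in>A 1. p 0 2 a = p 1 2 b \<longleftrightarrow> b = s"
      using inv[of 1 2 "p 0 2 a"] pA[OF a, of 2] by (auto simp: theta_arcs_def)
    obtain t where t: "t \<in> A 1" "\<forall>b\<in>A 1. p 0 3 a = p 1 3 b \<longleftrightarrow> b = t"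
      using inv[of 1 3 "p 0 3 a"] pA[OF a, of 3] by (auto simp: theta_arcs_def)
    obtain x where x: "x \<in> A 1" "\<forall>b\<in>A 1. p 4 5 (p 0 4 a) = p 1 5 b \<longleftrightarrow> b = x"
      using inv[of 1 5 "p 4 5 (p 0 4 a)"] pA[OF pA[OF a], of 4 5] by (auto simp: theta_arcs_def)
    obtain y where y: "y \<in> A 1" "\<forall>b\<in>A 1. p 6 7 (p 0 6 a) = p 1 7 b \<longleftrightarrow> b = y"
      using inv[of 1 7 "p 6 7 (p 0 6 a)"] pA[OF pA[OF a], of 6 7] by (auto simp: theta_arcs_def)
    obtain z where z: "z \<in> A 1" "\<forall>b\<in>A 1. p 8 9 (p 0 8 a) = p 1 9 b \<longleftrightarrow> b = z"
      using inv[of 1 9 "p 8 9 (p 0 8 a)"] pA[OF pA[OF a], of 8 9] by (auto simp: theta_arcs_def)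
    have "sum (?F a) (A 1) = (\<Sum>b\<in>A 1. path2_weight 3 (b = s) * (path2_weight 3 (b = t) *
        (path3_weight 3 (b = x) * (path3_weight 3 (b = y) * path3_weight 3 (b = z)))))"
      using s t x y z by (intro sum.cong) auto
    with theta_row_bound[OF _ s(1) t(1) x(1) y(1) z(1)] A(2)[of 1] show ?thesis by simp
  qed
  have "card (A 0) * 86 \<le> (\<Sum>a\<in>A 0. sum (?F a) (A 1))"
    using sum_bounded_below[of "A 0" 86, OF row] by simp
  \<comment> \<open>There are three colors at 0, and \<open>258 = 3 * 86\<close>.\<close>
  then have "258 \<le> (\<Sum>a\<in>A 0. sum (?F a) (A 1))"
    using A(2)[of 0] by simp
  from mult_le_mono2[OF this, of "3 ^ k"] show ?thesis
    by (simp add: card_theta_colorings[OF tw] mult.commute)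
qed

section \<open>The identity twist and the chromatic polynomial\<close>

text \<open>All five paths match exactly at \<open>b = a\<close>. The list \<open>S\<close> is left
  general because proper colorings use \<open>{1..m}\<close> while the constructed covers use
  \<open>{..<m}\<close>.\<close>

lemma card_theta_identity:
  assumes "finite S" "card S = m"
  shows "card (twisted_colorings (theta_graph k) (\<lambda>_. S) (\<lambda>_ _ a. a)) =
    m ^ k * (m * (path2_weight m True ^ 2 * path3_weight m True ^ 3
             + (m - 1) * (path2_weight m False ^ 2 * path3_weight m False ^ 3)))"
proof -
  have tw: "twists (theta_graph k) m (\<lambda>_. S) (\<lambda>_ _ a. a)"
    using assms by (simp add: twists_def bij_betw_def)
  have "(\<Sum>b\<in>S. path2_weight m (a = b) * (path2_weight m (a = b) *
      (path3_weight m (a = b) * (path3_weight m (a = b) * path3_weight m (a = b)))))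
    = path2_weight m True ^ 2 * path3_weight m True ^ 3
             + (m - 1) * (path2_weight m False ^ 2 * path3_weight m False ^ 3)" (is "sum ?F _ = ?R")
    if "a \<in> S" for a
  proof -
    have "sum ?F S = (\<Sum>b\<in>S. if b = a then path2_weight m True ^ 2 * path3_weight m True ^ 3
        else path2_weight m False ^ 2 * path3_weight m False ^ 3)"
      by (intro sum.cong) (auto simp: power2_eq_square power3_eq_cube)
    then show ?thesis using sum_two_values[OF assms(1) that] assms(2) by simp
  qed
  then show ?thesis using assms(2) by (simp add: card_theta_colorings[OF tw])
qed

lemma chromatic_polynomial_theta:
  "chromatic_polynomial (theta_graph k) m =
    m ^ k * (m * (path2_weight m True ^ 2 * path3_weight m True ^ 3
             + (m - 1) * (path2_weight m False ^ 2 * path3_weight m False ^ 3)))"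
proof -
  have "proper_colorings (theta_graph k) m = twisted_colorings (theta_graph k) (\<lambda>_. {1..m}) (\<lambda>_ _ a. a)"
  proof -
    have "(\<forall>u v. {u, v} \<in> edges (theta_graph k) \<longrightarrow> f u \<noteq> f v) \<longleftrightarrow>
        (\<forall>u v. u < v \<longrightarrow> {u, v} \<in> edges (theta_graph k) \<longrightarrow> f v \<noteq> f u)" for f :: "nat \<Rightarrow> nat"
    proof (intro iffI allI impI)
      fix u v assume *: "\<forall>u v. u < v \<longrightarrow> {u, v} \<in> edges (theta_graph k) \<longrightarrow> f v \<noteq> f u"
        and e: "{u, v} \<in> edges (theta_graph k)"
      \<comment> \<open>Proper colorings quantify over all pairs, so the degenerate pair, whose
        doubleton is a singleton and hence no edge, has to be excluded.\<close>
      have "u \<noteq> v" using finite_simple_theta[of k] e by (auto simp: finite_simple_graph_def)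
      then show "f u \<noteq> f v" using * e by (metis insert_commute linorder_neqE_nat)
    qed metis
    then show ?thesis by (simp add: proper_colorings_def twisted_colorings_def)
  qed
  then show ?thesis
    by (simp add: chromatic_polynomial_def card_theta_identity)
qed

section \<open>Twisting one edge by a cyclic shift\<close>

definition shift :: "nat \<Rightarrow> nat \<Rightarrow> nat" where
  "shift m a = (if Suc a = m then 0 else Suc a)"

lemma bij_betw_shift: "bij_betw (shift m) {..<m} {..<m}"
proof (rule bij_betwI[where g = "\<lambda>a. if a = 0 then m - 1 else a - 1"])
qed (auto simp: shift_def)

text \<open>Only the arc from 1 to 2 is twisted. For \<open>m \<ge> 2\<close> the shift has no fixed
  point, so the path through 2 matches at a different color than the other four.\<close>

definition shift_twist :: "nat \<Rightarrow> nat \<Rightarrow> nat \<Rightarrow> nat \<Rightarrow> nat" where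
  "shift_twist m u v = (if (u, v) = (1, 2) then shift m else (\<lambda>a. a))"

lemma twists_shift: "twists G m (\<lambda>_. {..<m}) (shift_twist m)"
  using bij_betw_shift by (auto simp: twists_def shift_twist_def bij_betw_def)

lemma card_theta_shift:
  "card (twisted_colorings (theta_graph k) (\<lambda>_. {..<m}) (shift_twist m)) =
    m ^ k * (\<Sum>a<m. \<Sum>b<m. path2_weight m (a = shift m b) * (path2_weight m (a = b) *
      path3_weight m (a = b) ^ 3))"
  by (subst card_theta_colorings[OF twists_shift]) (simp add: shift_twist_def power3_eq_cube mult.assoc)

text \<open>For \<open>m = 2\<close> a mismatch on a path of length 2 has weight 0, and its two
  paths never match simultaneously. For \<open>m = 1\<close> both weights of length 2 are 0, the
  mismatch weight by truncated subtraction.\<close>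

lemma card_theta_shift_small:
  assumes "m \<in> {1, 2}"
  shows "card (twisted_colorings (theta_graph k) (\<lambda>_. {..<m}) (shift_twist m)) = 0"
  using assms unfolding card_theta_shift
  by (auto simp: path2_weight_def shift_def numeral_2_eq_2 lessThan_Suc)

text \<open>For a color \<open>a\<close> at 0, the color \<open>b = a\<close> matches all paths
  except the one through 2, the cyclic predecessor of \<open>a\<close> matches only that path, and
  the other \<open>m - 2\<close> colors match none.\<close>

lemma card_theta_shift_large:
  assumes m: "m \<ge> 2"
  shows "card (twisted_colorings (theta_graph k) (\<lambda>_. {..<m}) (shift_twist m)) =
    m ^ k * (m * (path2_weight m False * path2_weight m True * path3_weight m True ^ 3
      + path2_weight m True * path2_weight m False * path3_weight m False ^ 3
      + (m - 2) * (path2_weight m False ^ 2 * path3_weight m False ^ 3)))" (is "_ = _ * (m * ?R)")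
proof -
  have "(\<Sum>b<m. path2_weight m (a = shift m b) * (path2_weight m (a = b) * path3_weight m (a = b) ^ 3))
      = ?R" (is "sum ?F _ = _") if a: "a < m" for a
  proof -
    have "a \<in> shift m ` {..<m}"
      using a bij_betw_imp_surj_on[OF bij_betw_shift] by simp
    then obtain t where t: "t < m" "shift m t = a" by auto
    then have eq: "a = shift m b \<longleftrightarrow> b = t" if "b < m" for b
      using bij_betw_shift[of m] that by (auto simp: bij_betw_def inj_on_def)
    \<comment> \<open>Here \<open>m \<ge> 2\<close> enters: the shift of a single color would be the
      identity.\<close>
    have ne: "a \<noteq> t" using t m by (auto simp: shift_def split: if_splits)
    have "sum ?F {..<m} = (\<Sum>b<m. if b = a then path2_weight m False * path2_weight m True * path3_weight m True ^ 3
       else if b = t then path2_weight m True * path2_weight m False * path3_weight m False ^ 3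
       else path2_weight m False ^ 2 * path3_weight m False ^ 3)"
      using eq ne by (intro sum.cong) (auto simp: power2_eq_square)
    also have "\<dots> = ?R"
      using sum_three_values[of "{..<m}" a t] a t ne by simp
    finally show ?thesis .
  qed
  then show ?thesis by (simp add: card_theta_shift)
qed

text \<open>After expansion the claim is \<open>n * (3 * e^2 + 3 * e + 1) < e^3\<close>. The bracket
  is at most \<open>7 * e^2\<close>, and \<open>n \<ge> 7\<close> gives
  \<open>e \<ge> 8 * n\<close>.\<close>

lemma cube_shift_less:
  fixes n e :: nat
  assumes "n \<ge> 7" and e: "e = n * (n + 1)"
  shows "n * (e + 1) ^ 3 < (n + 1) * e ^ 3"
proof -
  have "8 * n \<le> e" "1 \<le> e" using assms mult_le_mono2[of 8 "n + 1" n] by auto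
  have "n * (3 * e\<^sup>2 + 3 * e + 1) \<le> n * (7 * e\<^sup>2)"
    using \<open>1 \<le> e\<close> self_le_power[of e 2] one_le_power[of e 2] by (intro mult_le_mono2) linarith
  also have "\<dots> < 8 * n * e\<^sup>2"
    using assms \<open>1 \<le> e\<close> by simp
  also have "\<dots> \<le> e * e\<^sup>2"
    using \<open>8 * n \<le> e\<close> by (intro mult_le_mono1)
  finally show ?thesis
    by (simp add: power2_eq_square power3_eq_cube algebra_simps)
qed

lemma theta_shift_less_chromatic:
  assumes "m \<ge> 9"
  shows "card (twisted_colorings (theta_graph k) (\<lambda>_. {..<m}) (shift_twist m))
    < chromatic_polynomial (theta_graph k) m"
proof -
  \<comment> \<open>Substituting \<open>m = n + 2\<close> removes truncated subtraction: the weights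
    become \<open>n + 1\<close> and \<open>n\<close> for length 2, \<open>e\<close> and
    \<open>e + 1\<close> for length 3.\<close>
  define n where "n = m - 2"
  have m: "m = n + 2" and n: "n \<ge> 7" using assms by (auto simp: n_def)
  define e where "e = n * (n + 1)"
  have w: "path2_weight m True = n + 1" "path2_weight m False = n"
    "path3_weight m True = e" "path3_weight m False = e + 1"
    by (auto simp: path2_weight_def path3_weight_def m e_def)
  \<comment> \<open>The sums for the shift and for the identity share two terms; what remains is
    \<open>n * (e + 1) ^ 3\<close> against \<open>(n + 1) * e ^ 3\<close>.\<close>
  have "n * (n + 1) * e ^ 3 + (n + 1) * n * (e + 1) ^ 3 + n * (n\<^sup>2 * (e + 1) ^ 3)
      = n * (n + 1) * e ^ 3 + n\<^sup>2 * (n + 1) * (e + 1) ^ 3 + n * (e + 1) ^ 3"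
    by (simp add: power2_eq_square algebra_simps)
  also have "\<dots> < n * (n + 1) * e ^ 3 + n\<^sup>2 * (n + 1) * (e + 1) ^ 3 + (n + 1) * e ^ 3"
    using cube_shift_less[OF n e_def] by simp
  also have "\<dots> = (n + 1)\<^sup>2 * e ^ 3 + (n + 1) * (n\<^sup>2 * (e + 1) ^ 3)"
    by (simp add: power2_eq_square algebra_simps)
  finally have "m ^ k * (m * (n * (n + 1) * e ^ 3 + (n + 1) * n * (e + 1) ^ 3 + n * (n\<^sup>2 * (e + 1) ^ 3)))
      < m ^ k * (m * ((n + 1)\<^sup>2 * e ^ 3 + (n + 1) * (n\<^sup>2 * (e + 1) ^ 3)))"
    using m by (intro mult_strict_left_mono) auto
  moreover have "m - 1 = n + 1" "m - 2 = n" "2 \<le> m" using m by auto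
  ultimately show ?thesis
    by (simp only: chromatic_polynomial_theta card_theta_shift_large w)
qed

section \<open>DP-chromatic number and DP color function of the theta graphs\<close>

lemma card_twisted_cover_colorings_le:
  fixes G :: "'a::linorder ugraph"
  assumes G: "finite_simple_graph G"
  shows "card (cover_colorings G (twisted_cover G m p)) \<le> card (twisted_colorings G (\<lambda>_. {..<m}) p)"
proof -
  have "finite (twisted_colorings G (\<lambda>_. {..<m}) p)"
    using G by (intro finite_twisted_colorings) (auto simp: finite_simple_graph_def)
  then show ?thesis
    by (rule surj_card_le[OF _ twisted_cover_colorings[OF G]])
qed

lemma dp_color_function_le_twist:
  fixes G :: "'a::linorder ugraph"
  assumes G: "finite_simple_graph G" "m \<ge> 1" "twists G m (\<lambda>_. {..<m}) p"
  shows "dp_color_function G m \<le> card (twisted_colorings G (\<lambda>_. {..<m}) p)"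
proof -
  have "dp_color_function G m \<le> card (cover_colorings G (twisted_cover G m p))"
    unfolding dp_color_function_def using twisted_cover_full[OF assms] by (intro Least_le) blast
  also note card_twisted_cover_colorings_le[OF G(1)]
  finally show ?thesis .
qed

text \<open>Used twice: its positivity bounds the DP-chromatic number by 3, and on full covers it
  bounds the DP color function at 3 from below.\<close>

lemma theta_fold_cover_colorings:
  assumes "is_fold_cover (theta_graph k) 3 C"
  shows "258 * 3 ^ k \<le> card (cover_colorings (theta_graph k) C)"
proof -
  obtain A p where "twists (theta_graph k) 3 A p"
    "card (twisted_colorings (theta_graph k) A p) \<le> card (cover_colorings (theta_graph k) C)"
    by (rule fold_cover_dominates_twist[OF finite_simple_theta assms])
  with theta_colorings_lower[of k A p] show ?thesis by linarith
qed

lemma dp_chromatic_number_theta: "dp_chromatic_number (theta_graph k) = 3"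
  unfolding dp_chromatic_number_def
proof (rule Least_equality)
  have "cover_colorings (theta_graph k) C \<noteq> {}" if "is_fold_cover (theta_graph k) 3 C" for C
    using theta_fold_cover_colorings[OF that] by auto
  then show "1 \<le> (3::nat) \<and> (\<forall>C. is_fold_cover (theta_graph k) 3 C \<longrightarrow> cover_colorings (theta_graph k) C \<noteq> {})"
    by simp
next
  fix y :: nat
  assume y: "1 \<le> y \<and> (\<forall>C. is_fold_cover (theta_graph k) y C \<longrightarrow> cover_colorings (theta_graph k) C \<noteq> {})"
  show "3 \<le> y"
  proof (rule ccontr)
    assume "\<not> 3 \<le> y"
    with y have "y \<in> {1, 2}" by auto
    have "finite (twisted_colorings (theta_graph k) (\<lambda>_. {..<y}) (shift_twist y))"
      by (intro finite_twisted_colorings) (auto simp: theta_graph_def)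
    \<comment> \<open>With one or two colors the shift twist admits no coloring, so its cover
      refutes \<open>y\<close>.\<close>
    then have "twisted_colorings (theta_graph k) (\<lambda>_. {..<y}) (shift_twist y) = {}"
      using card_theta_shift_small[OF \<open>y \<in> {1, 2}\<close>, of k] by simp
    then have "cover_colorings (theta_graph k) (twisted_cover (theta_graph k) y (shift_twist y)) = {}"
      using twisted_cover_colorings[OF finite_simple_theta, of k y "shift_twist y"] by simp
    moreover have "is_fold_cover (theta_graph k) y (twisted_cover (theta_graph k) y (shift_twist y))"
      using twisted_cover_full[OF finite_simple_theta _ twists_shift] y
      by (simp add: is_full_fold_cover_def)
    ultimately show False using y by blast
  qed
qed

text \<open>The identity twist attains the lower bound valid for every 3-fold cover, and its
  colorings are as numerous as the proper ones.\<close>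

lemma dp_color_function_theta_3:
  "dp_color_function (theta_graph k) 3 = chromatic_polynomial (theta_graph k) 3"
proof -
  have P: "chromatic_polynomial (theta_graph k) 3 = 258 * 3 ^ k"
    by (simp add: chromatic_polynomial_theta path2_weight_def path3_weight_def power3_eq_cube)
  have id: "twists (theta_graph k) 3 (\<lambda>_. {..<3}) (\<lambda>_ _ a. a)"
    by (simp add: twists_def bij_betw_def)
  have "card (twisted_colorings (theta_graph k) (\<lambda>_. {..<3}) (\<lambda>_ _ a. a)) = 258 * 3 ^ k"
    by (simp add: card_theta_identity path2_weight_def path3_weight_def power3_eq_cube)
  then have "dp_color_function (theta_graph k) 3 \<le> 258 * 3 ^ k"
    using dp_color_function_le_twist[OF finite_simple_theta _ id] by simp
  moreover have "258 * 3 ^ k \<le> dp_color_function (theta_graph k) 3"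
    unfolding dp_color_function_def
  proof (rule LeastI2_ex)
    \<comment> \<open>The minimum ranges over a nonempty set, so \<open>LEAST\<close> returns one of
      its members.\<close>
    show "\<exists>n C. is_full_fold_cover (theta_graph k) 3 C \<and> n = card (cover_colorings (theta_graph k) C)"
      using twisted_cover_full[OF finite_simple_theta _ id] by auto
  qed (use theta_fold_cover_colorings in \<open>auto simp: is_full_fold_cover_def\<close>)
  ultimately show ?thesis using P by simp
qed

text \<open>The number of vertices is \<open>10 + k\<close>, so it determines
  \<open>k\<close>.\<close>

lemma isomorphic_thetaD: "isomorphic (theta_graph k) (theta_graph l) \<Longrightarrow> k = l"
  unfolding isomorphic_def by (auto dest: bij_betw_same_card simp: theta_graph_def)

theorem theorem1p8:
  shows "\<exists>\<G> :: nat ugraph set.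
           infinite \<G> \<and>
           pairwise (\<lambda>G G'. \<not> isomorphic G G') \<G> \<and>
           (\<forall>G\<in>\<G>.
              finite_simple_graph G \<and>
              dp_chromatic_number G = 3 \<and>
              dp_color_function G 3 = chromatic_polynomial G 3 \<and>
              (\<exists>N\<ge>1. \<forall>m\<ge>N. dp_color_function G m < chromatic_polynomial G m))"
proof (rule exI[of _ "range theta_graph"], intro conjI ballI)
  have "inj theta_graph"
    by (rule injI) (auto simp: theta_graph_def dest: lessThan_eq_iff[THEN iffD1])
  then show "infinite (range theta_graph)"
    using finite_imageD[of theta_graph UNIV] by auto
  show "pairwise (\<lambda>G G'. \<not> isomorphic G G') (range theta_graph)"
    using isomorphic_thetaD by (auto simp: pairwise_def)
  fix G assume "G \<in> range theta_graph"
  then obtain k where [simp]: "G = theta_graph k" by auto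
  show "finite_simple_graph G" "dp_chromatic_number G = 3"
    "dp_color_function G 3 = chromatic_polynomial G 3"
    by (simp_all add: finite_simple_theta dp_chromatic_number_theta dp_color_function_theta_3)
  \<comment> \<open>The threshold 9 is \<open>n \<ge> 7\<close> from the cube estimate, with
    \<open>m = n + 2\<close>.\<close>
  have "dp_color_function G m < chromatic_polynomial G m" if "m \<ge> 9" for m
    using dp_color_function_le_twist[OF finite_simple_theta _ twists_shift, of m k]
      theta_shift_less_chromatic[OF that, of k] that by simp
  then show "\<exists>N\<ge>1. \<forall>m\<ge>N. dp_color_function G m < chromatic_polynomial G m"
    by (intro exI[of _ 9]) simp
qed

end
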